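(* The set $\{1234,2143,3412,4321\}$ of $4$-point permutations is not quasirandom-forcing.
   Context: Permutations are written in one-line notation $\pi(1)\pi(2)\cdots\pi(k)$. Pattern density $d(\sigma,\pi)$: probability that a uniformly random $|\sigma|$-subset of positions of $\pi$ induces the pattern $\sigma$. A set $S$ of permutations is quasirandom-forcing if every sequence of permutations with sizes tending to infinity and $d(\sigma,\pi_n)\to1/|\sigma|!$ for all $\sigma\in S$ has $d(\sigma,\pi_n)\to1/|\sigma|!$ for all permutations $\sigma$. *)

theory Defs
  imports Complex_Main "HOL-Combinatorics.Multiset_Permutations"
begin

text \<open>Permutations are lists in one-line notation with entries \<open>1, \<dots>, k\<close>;
  list positions, in contrast, are counted from \<open>0\<close>.\<close>

definition is_perm :: "nat list \<Rightarrow> bool" where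
  "is_perm \<pi> \<longleftrightarrow> \<pi> \<in> permutations_of_set {1..length \<pi>}"

definition order_isomorphic :: "nat list \<Rightarrow> nat list \<Rightarrow> bool" where
  "order_isomorphic xs ys \<longleftrightarrow> length xs = length ys \<and>
     (\<forall>i<length xs. \<forall>j<length xs. xs ! i < xs ! j \<longleftrightarrow> ys ! i < ys ! j)"

definition pattern_occurrences :: "nat list \<Rightarrow> nat list \<Rightarrow> nat set set" where
  "pattern_occurrences \<sigma> \<pi> =
     {A. A \<subseteq> {..<length \<pi>} \<and> card A = length \<sigma> \<and> order_isomorphic (nths \<pi> A) \<sigma>}"

text \<open>If \<open>\<sigma>\<close> is longer than \<open>\<pi>\<close>, the denominator vanishes and the density is \<open>0\<close>.\<close>

definition pattern_density :: "nat list \<Rightarrow> nat list \<Rightarrow> real" where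
  "pattern_density \<sigma> \<pi> =
     real (card (pattern_occurrences \<sigma> \<pi>)) / real (length \<pi> choose length \<sigma>)"

definition quasirandom_forcing :: "nat list set \<Rightarrow> bool" where
  "quasirandom_forcing S \<longleftrightarrow>
     (\<forall>\<pi> :: nat \<Rightarrow> nat list.
        (\<forall>n. is_perm (\<pi> n)) \<longrightarrow>
        filterlim (\<lambda>n. length (\<pi> n)) at_top sequentially \<longrightarrow>
        (\<forall>\<sigma>\<in>S. (\<lambda>n. pattern_density \<sigma> (\<pi> n)) \<longlonglongrightarrow> 1 / fact (length \<sigma>)) \<longrightarrow>
        (\<forall>\<sigma>. is_perm \<sigma> \<longrightarrow> (\<lambda>n. pattern_density \<sigma> (\<pi> n)) \<longlonglongrightarrow> 1 / fact (length \<sigma>)))"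

end

theory Submission
  imports Defs
begin

text \<open>
  Replace the entries of a permutation \<open>\<tau>\<close> of size \<open>m\<close> by increasing or decreasing blocks of
  length \<open>n\<close>. The pattern formed by \<open>k\<close> entries of the result depends only on the blocks they lie
  in, so as \<open>n\<close> grows the density of a pattern \<open>\<sigma>\<close> of length \<open>k\<close> converges to \<open>w / m^k\<close>, where
  \<open>w\<close> adds up, over the ways to distribute the positions of \<open>\<sigma>\<close> over the blocks, the multinomial
  coefficients of the block multiplicities. For a suitable \<open>\<tau>\<close> of size 48, this number is \<open>48^4 / 24\<close>
  for each of the four patterns, but differs from \<open>48^3 / 6\<close> for the pattern 123.
\<close>

section \<open>Inflations of signed permutations and their weights\<close>

definition block :: "nat \<Rightarrow> nat \<times> bool \<Rightarrow> nat list" where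
  "block n b = (if snd b then [fst b * n + 1..<fst b * n + n + 1]
                else rev [fst b * n + 1..<fst b * n + n + 1])"

definition inflation :: "nat \<Rightarrow> (nat \<times> bool) list \<Rightarrow> nat list" where
  "inflation n bs = concat (map (block n) bs)"

text \<open>The occurrences of \<open>\<rho>\<close> in \<open>xs\<close> that can continue an occurrence of a longer pattern: a pair
  \<open>(t, v)\<close> in \<open>P\<close> records that an entry already chosen lies in the block at height \<open>t\<close> and plays the
  role of \<open>v\<close>. Blocks are recovered from entries as \<open>(x - 1) div n\<close>.\<close>

definition extensions :: "nat \<Rightarrow> (nat \<times> nat) list \<Rightarrow> nat list \<Rightarrow> nat list \<Rightarrow> nat set set" where
  "extensions n P \<rho> xs = {A. A \<subseteq> {..<length xs} \<and> order_isomorphic (nths xs A) \<rho> \<and>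
     (\<forall>p\<in>set P. \<forall>q\<in>set (zip (nths xs A) \<rho>). fst p < (fst q - 1) div n \<longleftrightarrow> snd p < snd q)}"

text \<open>Entries of different blocks compare as the heights of these blocks do, entries of one
  block by its direction. These two conditions therefore decide whether the next entries
  \<open>\<rho>\<close> of a pattern can all be taken from block \<open>b\<close>.\<close>

definition fits :: "(nat \<times> nat) list \<Rightarrow> nat \<times> bool \<Rightarrow> nat list \<Rightarrow> bool" where
  "fits P b \<rho> \<longleftrightarrow> (\<forall>p\<in>set P. \<forall>a\<in>set \<rho>. fst p < fst b \<longleftrightarrow> snd p < a) \<and>
     sorted_wrt (if snd b then (<) else (>)) \<rho>"

text \<open>The sum w of multinomial coefficients, read off block by block: \<open>j\<close> is the
  number of pattern entries placed in the first block, and the binomial coefficients met along the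
  way multiply to a multinomial one. \<open>P\<close> carries the entries placed so far.\<close>

fun weight :: "(nat \<times> nat) list \<Rightarrow> nat list \<Rightarrow> (nat \<times> bool) list \<Rightarrow> nat" where
  "weight P \<rho> [] = (if \<rho> = [] then 1 else 0)"
| "weight P \<rho> (b # bs) = (\<Sum>j\<le>length \<rho>. if fits P b (take j \<rho>)
     then (length \<rho> choose j) * weight (map (Pair (fst b)) (take j \<rho>) @ P) (drop j \<rho>) bs else 0)"

section \<open>Selections and order isomorphism in concatenated lists\<close>

lemma order_isomorphic_zip:
  "order_isomorphic xs ys \<longleftrightarrow> length xs = length ys \<and>
     (\<forall>p\<in>set (zip xs ys). \<forall>q\<in>set (zip xs ys). fst p < fst q \<longleftrightarrow> snd p < snd q)"
  unfolding order_isomorphic_def all_set_conv_all_nth by auto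

lemma length_nths_subset: "A \<subseteq> {..<length xs} \<Longrightarrow> length (nths xs A) = card A"
  by (auto simp: length_nths intro!: arg_cong[where f = card])

lemma pattern_occurrences_eq_extensions:
  "pattern_occurrences \<sigma> \<pi> = extensions n [] \<sigma> \<pi>"
  unfolding pattern_occurrences_def extensions_def
  by (auto simp: order_isomorphic_def length_nths_subset)

text \<open>A set of positions in \<open>ys @ zs\<close> is the same as a pair of sets of positions,
  one in \<open>ys\<close> and one in \<open>zs\<close>, the latter shifted by
  \<open>length ys\<close>.\<close>

lemma card_nths_append:
  "card {A. A \<subseteq> {..<length (ys @ zs)} \<and> Q (nths (ys @ zs) A)} =
     (\<Sum>B\<in>Pow {..<length ys}. card {C. C \<subseteq> {..<length zs} \<and> Q (nths ys B @ nths zs C)})"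
proof -
  let ?S = "SIGMA B:Pow {..<length ys}. {C. C \<subseteq> {..<length zs} \<and> Q (nths ys B @ nths zs C)}"
  let ?l = "length ys"
  let ?g = "\<lambda>A. (A \<inter> {..<?l}, {j. j + ?l \<in> A})"
  have nths_restrict: "nths ys (A \<inter> {..<?l}) = nths ys A" for A
    unfolding nths_def
    by (rule arg_cong[where f = "map fst"], rule filter_cong[OF refl]) (auto dest: set_zip_rightD)
  have "bij_betw ?g {A. A \<subseteq> {..<length (ys @ zs)} \<and> Q (nths (ys @ zs) A)} ?S"
  proof (rule bij_betw_byWitness[where f' = "\<lambda>(B, C). B \<union> (\<lambda>j. j + ?l) ` C"], goal_cases)
    case 1
    show ?case
    proof safe
      fix A x assume "A \<subseteq> {..<length (ys @ zs)}" "x \<in> A"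
        and *: "x \<notin> (\<lambda>j. j + length ys) ` {j. j + length ys \<in> A}"
      show "x < length ys"
      proof (rule ccontr)
        assume "\<not> x < length ys"
        then have "x = (x - ?l) + ?l" by simp
        with * \<open>x \<in> A\<close> show False by (metis (mono_tags, lifting) image_eqI mem_Collect_eq)
      qed
    qed
  next
    case 2
    show ?case by auto
  next
    case 3
    show ?case by (auto simp: nths_append nths_restrict)
  next
    case 4
    have "Q (nths (ys @ zs) (B \<union> (\<lambda>j. j + ?l) ` C))"
      if "B \<subseteq> {..<?l}" "C \<subseteq> {..<length zs}" "Q (nths ys B @ nths zs C)" for B C
    proof -
      have "(B \<union> (\<lambda>j. j + ?l) ` C) \<inter> {..<?l} = B" "{j. j + ?l \<in> B \<union> (\<lambda>j. j + ?l) ` C} = C"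
        using that by auto
      then show ?thesis
        using that(3) nths_restrict[of "B \<union> (\<lambda>j. j + ?l) ` C"] by (simp add: nths_append)
    qed
    then show ?case by fastforce
  qed
  then have "card {A. A \<subseteq> {..<length (ys @ zs)} \<and> Q (nths (ys @ zs) A)} = card ?S"
    by (rule bij_betw_same_card)
  also have "\<dots> = (\<Sum>B\<in>Pow {..<length ys}. card {C. C \<subseteq> {..<length zs} \<and> Q (nths ys B @ nths zs C)})"
    by (rule card_SigmaI) auto
  finally show ?thesis .
qed

lemma sum_Pow_card:
  assumes "finite S"
  shows "(\<Sum>B\<in>Pow S. h (card B)) = (\<Sum>j\<le>card S. (card S choose j) * h j :: nat)"
proof -
  have "(\<Sum>B\<in>Pow S. h (card B)) = (\<Sum>j\<le>card S. \<Sum>B\<in>{B \<in> Pow S. card B = j}. h (card B))"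
    using assms by (intro sum.group[symmetric]) (auto intro: card_mono)
  also have "\<dots> = (\<Sum>j\<le>card S. (card S choose j) * h j)"
    using n_subsets[OF assms] by (intro sum.cong) auto
  finally show ?thesis .
qed

text \<open>Distinctness makes the comparison condition symmetric in the two pairs, so across the
  cut one direction of comparison is enough.\<close>

lemma order_isomorphic_append:
  assumes "length u = length a" "distinct (u @ w)" "distinct (a @ b)"
  shows "order_isomorphic (u @ w) (a @ b) \<longleftrightarrow> order_isomorphic u a \<and> order_isomorphic w b \<and>
     (\<forall>p\<in>set (zip u a). \<forall>q\<in>set (zip w b). fst p < fst q \<longleftrightarrow> snd p < snd q)"
proof -
  define R :: "nat \<times> nat \<Rightarrow> nat \<times> nat \<Rightarrow> bool"
    where "R p q \<longleftrightarrow> (fst p < fst q \<longleftrightarrow> snd p < snd q)" for p q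
  define U W where "U = set (zip u a)" and "W = set (zip w b)"
  have sym: "R q p \<longleftrightarrow> R p q" if "p \<in> U" "q \<in> W" for p q
  proof -
    have "fst p \<in> set u" "fst q \<in> set w" "snd p \<in> set a" "snd q \<in> set b"
      using that unfolding U_def W_def
      by (metis prod.collapse set_zip_leftD set_zip_rightD)+
    then have "fst p \<noteq> fst q" "snd p \<noteq> snd q" using assms by auto
    then show ?thesis unfolding R_def by linarith
  qed
  have all: "(\<forall>p\<in>U \<union> W. \<forall>q\<in>U \<union> W. R p q) \<longleftrightarrow>
      (\<forall>p\<in>U. \<forall>q\<in>U. R p q) \<and> (\<forall>p\<in>W. \<forall>q\<in>W. R p q) \<and> (\<forall>p\<in>U. \<forall>q\<in>W. R p q)"
    using sym by blast
  have zip: "set (zip (u @ w) (a @ b)) = U \<union> W"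
    using assms(1) by (simp add: U_def W_def)
  have iso: "order_isomorphic x y \<longleftrightarrow>
      length x = length y \<and> (\<forall>p\<in>set (zip x y). \<forall>q\<in>set (zip x y). R p q)" for x y
    by (simp only: order_isomorphic_zip R_def)
  have len: "length (u @ w) = length (a @ b) \<longleftrightarrow> length w = length b"
    using assms(1) by simp
  show ?thesis
    unfolding R_def[symmetric] iso zip all len U_def[symmetric] W_def[symmetric]
    by (simp only: assms(1) simp_thms conj_ac)
qed

section \<open>Splitting off the first block\<close>

lemma set_block: "set (block n b) = {fst b * n + 1..fst b * n + n}"
  by (auto simp: block_def)

lemma length_block [simp]: "length (block n b) = n"
  by (simp add: block_def)

lemma distinct_block: "distinct (block n b)"
  by (simp add: block_def)

text \<open>Heights count from 0 but entries from 1, whence the shift before the division.\<close>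

lemma block_div:
  assumes "x \<in> set (block n b)"
  shows "x > 0" "(x - 1) div n = fst b"
proof -
  have x: "fst b * n < x" "x \<le> fst b * n + n" using assms by (auto simp: set_block)
  then obtain r where "x = fst b * n + r + 1" "r < n"
    by (metis Suc_eq_plus1 add_less_cancel_left less_eq_Suc_le less_imp_Suc_add)
  then show "x > 0" "(x - 1) div n = fst b" by auto
qed

lemma sorted_wrt_block: "sorted_wrt (if snd b then (<) else (>)) (block n b)"
  by (simp add: block_def sorted_wrt_rev del: upt_Suc)

lemma sorted_wrt_nths: "sorted_wrt R xs \<Longrightarrow> sorted_wrt R (nths xs A)"
proof (induction xs arbitrary: A)
  case (Cons x xs)
  then show ?case by (auto simp: nths_Cons dest: in_set_nthsD)
qed simp

text \<open>Strictly monotone lists of the same length and direction all have the same pattern. This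
  settles the entries chosen from a single block.\<close>

lemma order_isomorphic_sorted_wrt:
  assumes "length u = length a" "sorted_wrt (if s then (<) else (>)) u" "distinct a"
  shows "order_isomorphic u a \<longleftrightarrow> sorted_wrt (if s then (<) else (>)) a"
proof
  assume "order_isomorphic u a"
  then show "sorted_wrt (if s then (<) else (>)) a"
    using assms by (cases s) (auto simp: order_isomorphic_def sorted_wrt_iff_nth_less)
next
  assume a: "sorted_wrt (if s then (<) else (>)) a"
  show "order_isomorphic u a"
    unfolding order_isomorphic_def
  proof (intro conjI allI impI)
    fix i j assume ij: "i < length u" "j < length u"
    have u: "(if s then u ! k < u ! l else u ! l < u ! k)"
      and a: "(if s then a ! k < a ! l else a ! l < a ! k)" if "k < l" "l < length u" for k l
      using that assms(1,2) a by (cases s; simp add: sorted_wrt_iff_nth_less)+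
    show "u ! i < u ! j \<longleftrightarrow> a ! i < a ! j"
    proof (cases i j rule: linorder_cases)
      case less
      then show ?thesis using u[of i j] a[of i j] ij by (cases s) simp_all
    next
      case greater
      then show ?thesis using u[of j i] a[of j i] ij by (cases s) simp_all
    qed simp
  qed (fact assms)
qed

text \<open>If \<open>j\<close> positions are chosen in the first block, they must play the first
  \<open>j\<close> entries of \<open>\<rho>\<close>. Whether they can, and how the later entries
  must compare with them, depends only on the height and direction of the block. So all
  \<open>n choose j\<close> choices admit equally many continuations, and for these the
  \<open>j\<close> entries become new pairs in \<open>P\<close>.\<close>

lemma card_extensions_block:
  assumes "distinct \<rho>" "distinct zs" "\<And>z. z \<in> set zs \<Longrightarrow> z > 0 \<and> (z - 1) div n \<noteq> fst b"
  shows "card (extensions n P \<rho> (block n b @ zs)) = (\<Sum>j\<le>length \<rho>. if fits P b (take j \<rho>)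
     then (n choose j) * card (extensions n (map (Pair (fst b)) (take j \<rho>) @ P) (drop j \<rho>) zs) else 0)"
proof -
  let ?ys = "block n b"
  define Q where "Q l \<longleftrightarrow> order_isomorphic l \<rho> \<and>
    (\<forall>p\<in>set P. \<forall>q\<in>set (zip l \<rho>). fst p < (fst q - 1) div n \<longleftrightarrow> snd p < snd q)" for l
  \<comment> \<open>For \<open>j > length \<rho>\<close> the list \<open>take j \<rho>\<close> is
    still \<open>\<rho>\<close>, so the guard is what gives subsets that are too large the count
    0.\<close>
  define h where "h j = (if j \<le> length \<rho> \<and> fits P b (take j \<rho>)
    then card (extensions n (map (Pair (fst b)) (take j \<rho>) @ P) (drop j \<rho>) zs) else 0)" for j
  have h: "card {C. C \<subseteq> {..<length zs} \<and> Q (nths ?ys B @ nths zs C)} = h (card B)"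
    if B: "B \<subseteq> {..<n}" for B
  proof (cases "card B \<le> length \<rho>")
    case False
    then have "\<not> Q (nths ?ys B @ nths zs C)" for C
      using B by (auto simp: Q_def order_isomorphic_def length_nths_subset)
    with False show ?thesis by (simp add: h_def)
  next
    case True
    define u where "u = nths ?ys B"
    define a c where "a = take (card B) \<rho>" and "c = drop (card B) \<rho>"
    have \<rho>: "\<rho> = a @ c" by (simp add: a_def c_def)
    have len: "length u = length a"
      using B True by (simp add: u_def a_def length_nths_subset)
    have u_div: "x > 0" "(x - 1) div n = fst b" if "x \<in> set u" for x
      using that block_div[of x n b] by (auto simp: u_def dest: in_set_nthsD)
    have u_sorted: "sorted_wrt (if snd b then (<) else (>)) u"
      unfolding u_def by (intro sorted_wrt_nths sorted_wrt_block)
    have dist: "distinct (a @ c)" using assms(1) \<rho> by simp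
    have "Q (u @ nths zs C) \<longleftrightarrow> fits P b a \<and>
        order_isomorphic (nths zs C) c \<and>
        (\<forall>p\<in>set (map (Pair (fst b)) a @ P). \<forall>q\<in>set (zip (nths zs C) c).
           fst p < (fst q - 1) div n \<longleftrightarrow> snd p < snd q)" for C
    proof -
      let ?w = "nths zs C"
      have w: "fst q > 0 \<and> (fst q - 1) div n \<noteq> fst b" if "q \<in> set (zip ?w c)" for q
        using that assms(3) by (metis in_set_nthsD prod.collapse set_zip_leftD)
      \<comment> \<open>Division by \<open>n\<close> is monotone and the two heights differ, so
        comparing the entries amounts to comparing the heights.\<close>
      have cross: "fst p < fst q \<longleftrightarrow> fst b < (fst q - 1) div n"
        if "p \<in> set (zip u a)" "q \<in> set (zip ?w c)" for p q
      proof -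
        have p: "fst p > 0" "(fst p - 1) div n = fst b"
          using that(1) u_div by (metis prod.collapse set_zip_leftD)+
        show ?thesis
        proof
          assume "fst p < fst q"
          then have "(fst p - 1) div n \<le> (fst q - 1) div n" by (intro div_le_mono) simp
          with p w[OF that(2)] show "fst b < (fst q - 1) div n" by simp
        next
          assume "fst b < (fst q - 1) div n"
          show "fst p < fst q"
          proof (rule ccontr)
            assume "\<not> fst p < fst q"
            then have "(fst q - 1) div n \<le> (fst p - 1) div n" by (intro div_le_mono) simp
            with p \<open>fst b < _\<close> show False by simp
          qed
        qed
      qed
      have dist_uw: "distinct (u @ ?w)"
        using assms(2) block_div(2)[of _ n b] assms(3)
        by (auto simp: u_def distinct_nthsI distinct_block dest!: in_set_nthsD)
      have "order_isomorphic (u @ ?w) \<rho> \<longleftrightarrow> sorted_wrt (if snd b then (<) else (>)) a \<and>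
          order_isomorphic ?w c \<and>
          (\<forall>p\<in>set (zip u a). \<forall>q\<in>set (zip ?w c). fst b < (fst q - 1) div n \<longleftrightarrow> snd p < snd q)"
        unfolding \<rho> order_isomorphic_append[OF len dist_uw dist]
        using order_isomorphic_sorted_wrt[OF len u_sorted] dist cross by auto
      \<comment> \<open>With each entry of \<open>u\<close> replaced by the height of its block,
        only its pattern value is left, so the pairs can be written with \<open>a\<close> alone, as
        \<open>P\<close> requires.\<close>
      also have "(\<forall>p\<in>set (zip u a). \<forall>q\<in>set (zip ?w c). fst b < (fst q - 1) div n \<longleftrightarrow> snd p < snd q)
          \<longleftrightarrow> (\<forall>p\<in>set (map (Pair (fst b)) a). \<forall>q\<in>set (zip ?w c).
                fst p < (fst q - 1) div n \<longleftrightarrow> snd p < snd q)" (is "?L \<longleftrightarrow> ?R")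
      proof -
        have "?L \<longleftrightarrow> (\<forall>v\<in>snd ` set (zip u a). \<forall>q\<in>set (zip ?w c). fst b < (fst q - 1) div n \<longleftrightarrow> v < snd q)"
          by simp
        also have "snd ` set (zip u a) = set a"
          using len by (metis map_snd_zip set_map)
        finally show ?thesis by simp
      qed
      finally have 1: "order_isomorphic (u @ ?w) \<rho> \<longleftrightarrow>
          sorted_wrt (if snd b then (<) else (>)) a \<and> order_isomorphic ?w c \<and>
          (\<forall>p\<in>set (map (Pair (fst b)) a). \<forall>q\<in>set (zip ?w c).
             fst p < (fst q - 1) div n \<longleftrightarrow> snd p < snd q)" .
      have "(\<forall>q\<in>set (zip u a). fst p < (fst q - 1) div n \<longleftrightarrow> snd p < snd q) \<longleftrightarrow>
          (\<forall>v\<in>set a. fst p < fst b \<longleftrightarrow> snd p < v)" for p :: "nat \<times> nat"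
      proof -
        have zip_u_div: "(fst q - 1) div n = fst b" if "q \<in> set (zip u a)" for q
          using that u_div(2) by (metis prod.collapse set_zip_leftD)
        have "(\<forall>q\<in>set (zip u a). fst p < (fst q - 1) div n \<longleftrightarrow> snd p < snd q) \<longleftrightarrow>
            (\<forall>v\<in>snd ` set (zip u a). fst p < fst b \<longleftrightarrow> snd p < v)"
          using zip_u_div by simp
        also have "snd ` set (zip u a) = set a"
          using len by (metis map_snd_zip set_map)
        finally show ?thesis .
      qed
      then have 2: "(\<forall>p\<in>set P. \<forall>q\<in>set (zip (u @ ?w) \<rho>). fst p < (fst q - 1) div n \<longleftrightarrow> snd p < snd q)
          \<longleftrightarrow> (\<forall>p\<in>set P. \<forall>v\<in>set a. fst p < fst b \<longleftrightarrow> snd p < v) \<and>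
            (\<forall>p\<in>set P. \<forall>q\<in>set (zip ?w c). fst p < (fst q - 1) div n \<longleftrightarrow> snd p < snd q)"
        unfolding \<rho> zip_append[OF len] set_append ball_Un by blast
      show ?thesis
        unfolding Q_def 1 2 fits_def set_append ball_Un by blast
    qed
    then have "{C. C \<subseteq> {..<length zs} \<and> Q (u @ nths zs C)} =
        (if fits P b a then extensions n (map (Pair (fst b)) a @ P) c zs else {})"
      unfolding extensions_def by simp
    then show ?thesis using True by (simp add: h_def u_def a_def c_def)
  qed
  have "card (extensions n P \<rho> (?ys @ zs)) =
      card {A. A \<subseteq> {..<length (?ys @ zs)} \<and> Q (nths (?ys @ zs) A)}"
    unfolding extensions_def Q_def by simp
  also have "\<dots> = (\<Sum>B\<in>Pow {..<n}. h (card B))"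
    unfolding card_nths_append using h by (intro sum.cong) auto
  also have "\<dots> = (\<Sum>j\<le>n. (n choose j) * h j)"
    using sum_Pow_card[of "{..<n}" h] by simp
  \<comment> \<open>Passing through the maximum changes the range from \<open>n\<close> to
    \<open>length \<rho>\<close>: the binomial coefficient vanishes beyond \<open>n\<close>, and
    \<open>h\<close> beyond \<open>length \<rho>\<close>.\<close>
  also have "\<dots> = (\<Sum>j\<le>max n (length \<rho>). (n choose j) * h j)"
    by (intro sum.mono_neutral_left) (auto simp: binomial_eq_0)
  also have "\<dots> = (\<Sum>j\<le>length \<rho>. (n choose j) * h j)"
    by (intro sum.mono_neutral_right) (auto simp: h_def)
  also have "\<dots> = (\<Sum>j\<le>length \<rho>. if fits P b (take j \<rho>)
     then (n choose j) * card (extensions n (map (Pair (fst b)) (take j \<rho>) @ P) (drop j \<rho>) zs) else 0)"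
    by (intro sum.cong) (auto simp: h_def)
  finally show ?thesis .
qed

section \<open>Limits of pattern densities in inflations\<close>

lemma binomial_asymp: "(\<lambda>n. real (n choose k) / real n ^ k) \<longlonglongrightarrow> 1 / fact k"
proof (induction k)
  case (Suc k)
  have "(\<lambda>n. real (n choose k) / real n ^ k * (1 - real k / real n) / real (Suc k))
      \<longlonglongrightarrow> 1 / fact k * (1 - 0) / real (Suc k)"
    by (intro tendsto_intros Suc lim_const_over_n) auto
  \<comment> \<open>Both sides of \<open>Suc k * (n choose Suc k) = (n - k) * (n choose k)\<close>
    equal \<open>n * (n - 1 choose k)\<close>. The bound \<open>n > k\<close> keeps
    \<open>n - k\<close> from being truncated and \<open>n\<close> from being 0.\<close>
  moreover have "real (n choose k) / real n ^ k * (1 - real k / real n) / real (Suc k) =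
      real (n choose Suc k) / real n ^ Suc k" if "n > k" for n
  proof -
    have "Suc k * (n choose Suc k) = (n - k) * (n choose k)"
      unfolding binomial_absorption binomial_absorb_comp ..
    then have "real (Suc k) * real (n choose Suc k) = real (n - k) * real (n choose k)"
      by (metis of_nat_mult)
    then have *: "real (n choose Suc k) = real (n choose k) * (real n - real k) / real (Suc k)"
      using that by (simp add: field_simps of_nat_diff)
    have "1 - real k / real n = (real n - real k) / real n"
      using that by (simp add: field_simps)
    then show ?thesis unfolding * by simp
  qed
  ultimately show ?case
    by (rule_tac Lim_transform_eventually)
      (auto simp: eventually_sequentially mult.commute simp del: binomial_Suc_Suc
        intro!: exI[of _ "Suc k"])
qed simp

lemma set_inflation: "set (inflation n bs) = (\<Union>b\<in>set bs. {fst b * n + 1..fst b * n + n})"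
  by (simp add: inflation_def set_block)

lemma inflation_div:
  assumes "z \<in> set (inflation n bs)"
  shows "z > 0" "(z - 1) div n \<in> fst ` set bs"
  using assms block_div[of z n] by (force simp: inflation_def)+

lemma length_inflation: "length (inflation n bs) = length bs * n"
  by (simp add: inflation_def length_concat comp_def sum_list_triv)

lemma distinct_inflation: "distinct (map fst bs) \<Longrightarrow> distinct (inflation n bs)"
proof (induction bs)
  case (Cons b bs)
  have "x \<notin> set (inflation n bs)" if "x \<in> set (block n b)" for x
    using inflation_div(2)[of x n bs] block_div(2)[OF that] Cons.prems by auto
  with Cons show ?case by (auto simp: inflation_def distinct_block)
qed (simp add: inflation_def)

text \<open>There are as many distinct heights as there are possible values, so every value occurs
  once and the value intervals of the blocks tile \<open>{1..length bs * n}\<close>.\<close>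

lemma is_perm_inflation:
  assumes "distinct (map fst bs)" "fst ` set bs \<subseteq> {..<length bs}"
  shows "is_perm (inflation n bs)"
proof -
  have "card (fst ` set bs) = length bs"
    using distinct_card[OF assms(1)] by simp
  with assms(2) have fst_bs: "fst ` set bs = {..<length bs}"
    by (intro card_subset_eq) simp_all
  have "set (inflation n bs) = (\<Union>t\<in>{..<length bs}. {t * n + 1..t * n + n})"
    unfolding set_inflation fst_bs[symmetric] by simp
  also have "\<dots> = {1..length bs * n}"
  proof (intro equalityI subsetI)
    fix x assume "x \<in> (\<Union>t\<in>{..<length bs}. {t * n + 1..t * n + n})"
    then obtain t where t: "t < length bs" "t * n + 1 \<le> x" "x \<le> t * n + n" by auto
    have "Suc t * n \<le> length bs * n" using t(1) by (intro mult_le_mono1) simp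
    with t show "x \<in> {1..length bs * n}" by simp
  next
    fix x assume x: "x \<in> {1..length bs * n}"
    then have "n > 0" by (cases n) auto
    then obtain q r where qr: "x - 1 = q * n + r" "r < n"
      by (metis div_mult_mod_eq mod_less_divisor)
    then have "q * n < length bs * n" using x unfolding atLeastAtMost_iff by linarith
    then have "q < length bs" by simp
    moreover have "x = q * n + r + 1" using qr x by auto
    ultimately show "x \<in> (\<Union>t\<in>{..<length bs}. {t * n + 1..t * n + n})"
      using qr(2) by (intro UN_I[of q]) auto
  qed
  finally show ?thesis
    using distinct_inflation[OF assms(1)]
    by (simp add: is_perm_def permutations_of_set_def length_inflation)
qed

text \<open>Induction over the blocks, with k = \<open>length \<rho>\<close>. In the summand for
  \<open>j\<close>, the power n^k splits into n^j, which turns \<open>n choose j\<close> into 1/j!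
  in the limit, and n^(k-j), which the induction hypothesis absorbs. Finally 1/(j! (k-j)!) is
  \<open>k choose j\<close> divided by k!, the coefficient in \<open>weight\<close>.\<close>

lemma card_extensions_asymp:
  assumes "distinct (map fst bs)" "distinct \<rho>"
  shows "(\<lambda>n. real (card (extensions n P \<rho> (inflation n bs))) / real n ^ length \<rho>)
           \<longlonglongrightarrow> real (weight P \<rho> bs) / fact (length \<rho>)"
  using assms
proof (induction bs arbitrary: P \<rho>)
  case Nil
  have "extensions n P \<rho> [] = (if \<rho> = [] then {{}} else {})" for n
    by (auto simp: extensions_def order_isomorphic_def)
  then show ?case by (simp add: inflation_def)
next
  case (Cons b bs)
  let ?P = "\<lambda>j. map (Pair (fst b)) (take j \<rho>) @ P"
  let ?c = "\<lambda>n j. card (extensions n (?P j) (drop j \<rho>) (inflation n bs))"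
  let ?k = "length \<rho>"
  have "card (extensions n P \<rho> (inflation n (b # bs))) = (\<Sum>j\<le>?k. if fits P b (take j \<rho>)
     then (n choose j) * ?c n j else 0)" for n
  proof -
    have "z > 0 \<and> (z - 1) div n \<noteq> fst b" if "z \<in> set (inflation n bs)" for z
      using inflation_div[OF that] Cons.prems(1) by (metis distinct.simps(2) list.simps(9) set_map)
    moreover have "distinct (inflation n bs)" using Cons.prems(1) by (simp add: distinct_inflation)
    ultimately have "card (extensions n P \<rho> (block n b @ inflation n bs)) =
        (\<Sum>j\<le>?k. if fits P b (take j \<rho>) then (n choose j) * ?c n j else 0)"
      using Cons.prems(2) by (intro card_extensions_block) auto
    then show ?thesis by (simp add: inflation_def)
  qed
  then have eq: "real (card (extensions n P \<rho> (inflation n (b # bs)))) / real n ^ ?k =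
      (\<Sum>j\<le>?k. if fits P b (take j \<rho>)
        then real (n choose j) / real n ^ j * (real (?c n j) / real n ^ (?k - j)) else 0)" for n
    by (auto simp: sum_divide_distrib simp flip: power_add intro!: sum.cong)
  have "(\<lambda>n. real (n choose j) / real n ^ j * (real (?c n j) / real n ^ (?k - j)))
      \<longlonglongrightarrow> 1 / fact j * (real (weight (?P j) (drop j \<rho>) bs) / fact (?k - j))" for j
    using Cons.IH[of "drop j \<rho>" "?P j"] Cons.prems by (intro tendsto_mult binomial_asymp) simp
  then have "(\<lambda>n. real (card (extensions n P \<rho> (inflation n (b # bs)))) / real n ^ ?k)
      \<longlonglongrightarrow> (\<Sum>j\<le>?k. if fits P b (take j \<rho>)
            then 1 / fact j * (real (weight (?P j) (drop j \<rho>) bs) / fact (?k - j)) else 0)"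
    unfolding eq by (intro tendsto_sum) auto
  also have "(\<Sum>j\<le>?k. if fits P b (take j \<rho>)
            then 1 / fact j * (real (weight (?P j) (drop j \<rho>) bs) / fact (?k - j)) else 0) =
      real (weight P \<rho> (b # bs)) / fact ?k"
    by (auto simp: sum_divide_distrib binomial_fact intro!: sum.cong)
  finally show ?case .
qed

text \<open>The denominator of the density is asymptotically (m n)^k / k!, so k! cancels against the
  one in the count of occurrences and m^k remains.\<close>

lemma pattern_density_inflation:
  assumes "distinct (map fst bs)" "distinct \<sigma>" "bs \<noteq> []"
  shows "(\<lambda>n. pattern_density \<sigma> (inflation n bs))
           \<longlonglongrightarrow> real (weight [] \<sigma> bs) / real (length bs) ^ length \<sigma>"
proof -
  let ?m = "length bs" and ?k = "length \<sigma>"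
  have m: "?m > 0" using assms(3) by simp
  have "filterlim (\<lambda>n. ?m * n) sequentially sequentially"
    using m by (intro mult_nat_left_at_top)
  from filterlim_compose[OF binomial_asymp this]
  have "(\<lambda>n. real (?m * n choose ?k) / real (?m * n) ^ ?k) \<longlonglongrightarrow> 1 / fact ?k" .
  from tendsto_divide[OF tendsto_divide[OF card_extensions_asymp[OF assms(1,2), of "[]"] this]
      tendsto_const[of "real ?m ^ ?k"]]
  have "(\<lambda>n. real (card (extensions n [] \<sigma> (inflation n bs))) / real n ^ ?k /
        (real (?m * n choose ?k) / real (?m * n) ^ ?k) / real ?m ^ ?k)
      \<longlonglongrightarrow> real (weight [] \<sigma> bs) / real ?m ^ ?k"
    using m by simp
  moreover have "real (card (extensions n [] \<sigma> (inflation n bs))) / real n ^ ?k /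
        (real (?m * n choose ?k) / real (?m * n) ^ ?k) / real ?m ^ ?k =
      pattern_density \<sigma> (inflation n bs)" if "n > 0" for n
    using that m
    by (simp add: pattern_density_def length_inflation power_mult_distrib
        flip: pattern_occurrences_eq_extensions)
  ultimately show ?thesis
    by (rule_tac Lim_transform_eventually) (auto simp: eventually_sequentially intro!: exI[of _ 1])
qed

section \<open>A signed permutation of size 48 and the evaluation of its weights\<close>

text \<open>Found by a computer search among the signed permutations that are invariant under rotation by
  90 degrees; the rotation exchanges 1234 with 4321 and 2143 with 3412. Only the suffixes of the list
  are named, so that the simplifier does not traverse the whole list at every step.\<close>

definition tail :: "nat \<Rightarrow> (nat \<times> bool) list" where
  "tail k = drop k
    [(28, False), (32, True), (3, False), (45, True), (7, False), (34, True),
     (36, True), (43, True), (25, False), (26, True), (23, True), (6, False),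
     (31, True), (5, False), (27, True), (1, False), (12, False), (29, False),
     (17, True), (0, True), (14, False), (9, False), (8, True), (37, False),
     (10, False), (39, True), (38, False), (33, False), (47, True), (30, True),
     (18, False), (35, False), (46, False), (20, True), (42, False), (16, True),
     (41, False), (24, True), (21, True), (22, False), (4, True), (11, True),
     (13, True), (40, False), (2, True), (44, False), (15, True), (19, False)]"

lemma tail_simps:
  "tail 0 = (28, False) # tail 1" "tail 1 = (32, True) # tail 2"
  "tail 2 = (3, False) # tail 3" "tail 3 = (45, True) # tail 4"
  "tail 4 = (7, False) # tail 5" "tail 5 = (34, True) # tail 6"
  "tail 6 = (36, True) # tail 7" "tail 7 = (43, True) # tail 8"
  "tail 8 = (25, False) # tail 9" "tail 9 = (26, True) # tail 10"
  "tail 10 = (23, True) # tail 11" "tail 11 = (6, False) # tail 12"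
  "tail 12 = (31, True) # tail 13" "tail 13 = (5, False) # tail 14"
  "tail 14 = (27, True) # tail 15" "tail 15 = (1, False) # tail 16"
  "tail 16 = (12, False) # tail 17" "tail 17 = (29, False) # tail 18"
  "tail 18 = (17, True) # tail 19" "tail 19 = (0, True) # tail 20"
  "tail 20 = (14, False) # tail 21" "tail 21 = (9, False) # tail 22"
  "tail 22 = (8, True) # tail 23" "tail 23 = (37, False) # tail 24"
  "tail 24 = (10, False) # tail 25" "tail 25 = (39, True) # tail 26"
  "tail 26 = (38, False) # tail 27" "tail 27 = (33, False) # tail 28"
  "tail 28 = (47, True) # tail 29" "tail 29 = (30, True) # tail 30"
  "tail 30 = (18, False) # tail 31" "tail 31 = (35, False) # tail 32"
  "tail 32 = (46, False) # tail 33" "tail 33 = (20, True) # tail 34"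
  "tail 34 = (42, False) # tail 35" "tail 35 = (16, True) # tail 36"
  "tail 36 = (41, False) # tail 37" "tail 37 = (24, True) # tail 38"
  "tail 38 = (21, True) # tail 39" "tail 39 = (22, False) # tail 40"
  "tail 40 = (4, True) # tail 41" "tail 41 = (11, True) # tail 42"
  "tail 42 = (13, True) # tail 43" "tail 43 = (40, False) # tail 44"
  "tail 44 = (2, True) # tail 45" "tail 45 = (44, False) # tail 46"
  "tail 46 = (15, True) # tail 47" "tail 47 = (19, False) # tail 48"
  by (simp_all add: tail_def)

lemma tail_48: "tail 48 = []"
  by (simp add: tail_def)

lemma weight_Nil: "weight P [] bs = 1"
  by (induction bs arbitrary: P) (simp_all add: fits_def)

definition agrees :: "(nat \<times> nat) list \<Rightarrow> nat \<Rightarrow> nat \<Rightarrow> bool" where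
  "agrees P t a \<longleftrightarrow> list_all (\<lambda>p. (fst p < t) = (snd p < a)) P"

text \<open>The conjunction is written with \<open>if\<close> so that, under
  \<open>if_weak_cong\<close>, the condition is decided first and the rest is rewritten only if it
  holds.\<close>

lemma agrees_simps:
  "agrees [] t a = True"
  "agrees (p # P) t a = (if (fst p < t) = (snd p < a) then agrees P t a else False)"
  by (auto simp: agrees_def)

lemma fits_singleton: "fits P b [a] \<longleftrightarrow> agrees P (fst b) a"
  by (auto simp: fits_def agrees_def list_all_iff)

lemma fits_Cons:
  "fits P (t, s) (a # c # \<rho>) \<longleftrightarrow> (if (if s then a < c else c < a)
     then (if agrees P t a then fits P (t, s) (c # \<rho>) else False) else False)"
  by (cases s) (auto simp: fits_def agrees_def list_all_iff)

lemma fits_Nil: "fits P b []"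
  by (simp add: fits_def)

text \<open>This rule and the next three unfold \<open>weight\<close> for pattern lengths 1 to 4,
  with binomial coefficients as numerals. Prefixes of fitting lists fit, so the conditions can be
  nested and the first failure cuts off all longer segments.\<close>

lemma weight_step1:
  assumes "bs = (t, s) # bs'"
  shows "weight P [a] bs = (if agrees P t a then Suc (weight P [a] bs') else weight P [a] bs')"
  using assms by (simp add: weight_Nil fits_singleton fits_Nil)

lemma weight_step2:
  assumes "bs = (t, s) # bs'"
  shows "weight P [a, c] bs = weight P [a, c] bs' + (if agrees P t a
    then 2 * weight ((t, a) # P) [c] bs' + (if fits P (t, s) [a, c] then 1 else 0) else 0)"
  using assms
  by (auto simp: weight_Nil fits_singleton fits_Nil fits_Cons numeral_2_eq_2 split: if_splits)

lemma weight_step3: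
  assumes "bs = (t, s) # bs'"
  shows "weight P [a, c, d] bs = weight P [a, c, d] bs' + (if agrees P t a
    then 3 * weight ((t, a) # P) [c, d] bs' + (if fits P (t, s) [a, c]
      then 3 * weight ((t, a) # (t, c) # P) [d] bs' +
        (if fits P (t, s) [a, c, d] then 1 else 0) else 0) else 0)"
  using assms
  by (auto simp: weight_Nil fits_singleton fits_Nil fits_Cons eval_nat_numeral split: if_splits)

lemma weight_step4:
  assumes "bs = (t, s) # bs'"
  shows "weight P [a, c, d, e] bs = weight P [a, c, d, e] bs' + (if agrees P t a
    then 4 * weight ((t, a) # P) [c, d, e] bs' + (if fits P (t, s) [a, c]
      then 6 * weight ((t, a) # (t, c) # P) [d, e] bs' + (if fits P (t, s) [a, c, d]
        then 4 * weight ((t, a) # (t, c) # (t, d) # P) [e] bs' +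
          (if fits P (t, s) [a, c, d, e] then 1 else 0) else 0) else 0) else 0)"
  using assms
  by (auto simp: weight_Nil fits_singleton fits_Nil fits_Cons eval_nat_numeral split: if_splits)

text \<open>Instantiating the four rules at every suffix makes rewriting proceed from one named
  suffix to the next without exposing the list. The other rules decide the conditions and evaluate
  numerals.\<close>

lemmas weight_tail = tail_simps[THEN weight_step1] tail_simps[THEN weight_step2]
  tail_simps[THEN weight_step3] tail_simps[THEN weight_step4] tail_48 weight.simps(1)
  agrees_simps fits_Cons fits_singleton fst_conv snd_conv if_True if_False list.simps simp_thms
  arith_simps rel_simps arith_special Suc_numeral Suc_eq_plus1 mult_1_right

lemma weight_tail_123: "weight [] [1, 2, 3] (tail 0) = 18792"
  by (simp only: weight_tail cong: if_weak_cong)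

lemma weight_tail_1234: "weight [] [1, 2, 3, 4] (tail 0) = 221184"
  by (simp only: weight_tail cong: if_weak_cong)

lemma weight_tail_2143: "weight [] [2, 1, 4, 3] (tail 0) = 221184"
  by (simp only: weight_tail cong: if_weak_cong)

lemma weight_tail_3412: "weight [] [3, 4, 1, 2] (tail 0) = 221184"
  by (simp only: weight_tail cong: if_weak_cong)

lemma weight_tail_4321: "weight [] [4, 3, 2, 1] (tail 0) = 221184"
  by (simp only: weight_tail cong: if_weak_cong)

section \<open>Contradiction from the density of the pattern 123\<close>

theorem theorem16:
  "\<not> quasirandom_forcing {[1,2,3,4], [2,1,4,3], [3,4,1,2], [4,3,2,1]}"
proof
  let ?S = "{[1,2,3,4], [2,1,4,3], [3,4,1,2], [4,3,2,1]} :: nat list set"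
  let ?\<pi> = "\<lambda>n. inflation n (tail 0)"
  assume forcing: "quasirandom_forcing ?S"
  have tail: "distinct (map fst (tail 0))" "fst ` set (tail 0) \<subseteq> {..<length (tail 0)}"
    "length (tail 0) = 48" "tail 0 \<noteq> []"
    by (simp_all add: tail_def)
  have density: "(\<lambda>n. pattern_density \<sigma> (?\<pi> n)) \<longlonglongrightarrow> real (weight [] \<sigma> (tail 0)) / 48 ^ length \<sigma>"
    if "distinct \<sigma>" for \<sigma>
    using pattern_density_inflation[OF tail(1) that tail(4)] by (simp add: tail(3))
  have perm: "\<forall>n. is_perm (?\<pi> n)"
    using is_perm_inflation[OF tail(1,2)] by blast
  have len: "filterlim (\<lambda>n. length (?\<pi> n)) at_top sequentially"
    unfolding length_inflation tail(3) by (intro mult_nat_left_at_top) simp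
  have lim: "\<forall>\<sigma>\<in>?S. (\<lambda>n. pattern_density \<sigma> (?\<pi> n)) \<longlonglongrightarrow> 1 / fact (length \<sigma>)"
  proof
    fix \<sigma> assume "\<sigma> \<in> ?S"
    \<comment> \<open>The value 221184 is 48^4 / 24, which makes the limit 1/24 = 1/4!.\<close>
    then have "distinct \<sigma>" "length \<sigma> = 4" "weight [] \<sigma> (tail 0) = 221184"
      using weight_tail_1234 weight_tail_2143 weight_tail_3412 weight_tail_4321 by auto
    with density[of \<sigma>] show "(\<lambda>n. pattern_density \<sigma> (?\<pi> n)) \<longlonglongrightarrow> 1 / fact (length \<sigma>)"
      by (simp add: fact_numeral)
  qed
  have perm_123: "is_perm [1, 2, 3]"
    by (auto simp: is_perm_def permutations_of_set_def)
  have "(\<lambda>n. pattern_density [1, 2, 3] (?\<pi> n)) \<longlonglongrightarrow> 1 / fact (length [1, 2, 3 :: nat])"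
    using forcing[unfolded quasirandom_forcing_def, THEN spec[where x = ?\<pi>], THEN mp, OF perm,
        THEN mp, OF len, THEN mp, OF lim, THEN spec, THEN mp, OF perm_123] .
  \<comment> \<open>A limit of 1/6 would need the weight 48^3 / 6 = 18432 instead of 18792.\<close>
  moreover have "(\<lambda>n. pattern_density [1, 2, 3] (?\<pi> n)) \<longlonglongrightarrow> 18792 / 48 ^ 3"
    using density[of "[1, 2, 3]"] unfolding weight_tail_123 by simp
  ultimately have "1 / fact (length [1, 2, 3 :: nat]) = (18792 / 48 ^ 3 :: real)"
    by (rule LIMSEQ_unique)
  then show False
    by (simp add: fact_numeral)
qed

end
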